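(* Let $A\in\mathbb{R}^{m\times n}$, let $P\in\mathbb{R}^{m\times m}$ and $Q\in\mathbb{R}^{n\times n}$ be symmetric positive semidefinite, $G=A^{\top}PA+Q$, and let $b\in\mathbb{R}^m$ with $PP^{\dagger}b\neq\mathbf{0}$. Suppose the generalized Golub-Kahan bidiagonalization (gGKB) process for $\{A,P,Q,b\}$ terminates at step $k_t$. Then the vector $x_{k_t}$ obtained by the generalized LSQR (gLSQR) algorithm is the exact minimum 2-norm solution of $$\min_{x\in\mathbb{R}^{n}}\|x\|_{Q}\quad\text{s.t.}\quad\|Ax-b\|_{P}=\min.$$
   Context: $\dagger$ is the Moore-Penrose pseudoinverse, and $\|x\|_C=(x^{\top}Cx)^{1/2}$ for symmetric positive semidefinite $C$. A solution of the displayed generalized least squares problem is a vector minimizing $\|x\|_Q$ among all minimizers of $\|Ax-b\|_P$ over $\mathbb{R}^n$; the minimum 2-norm solution is the solution of smallest Euclidean norm. gGKB process (in exact arithmetic): with $v_0:=\mathbf{0}$, $$\beta_1u_1=PP^{\dagger}b,\qquad \alpha_iv_i=G^{\dagger}A^{\top}Pu_i-\beta_iv_{i-1},\qquad \beta_{i+1}u_{i+1}=PP^{\dagger}Av_i-\alpha_iu_i\quad(i\ge1),$$ where $\alpha_i,\beta_i\ge0$ are the normalizing scalars: $\beta_i$ is the $\|\cdot\|_P$-norm of the corresponding right-hand side, so $\|u_i\|_P=1$ if $\beta_i>0$, and $\alpha_i$ is the $\|\cdot\|_G$-norm of the corresponding right-hand side, so $\|v_i\|_G=1$ if $\alpha_i>0$.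 If a scalar is zero, the corresponding vector is set to $\mathbf{0}$ (thus $\beta_{i+1}=0$ gives $u_{i+1}=\mathbf{0}$, $\alpha_{i+1}=0$) and the process stops. The termination step is $k_t=\min\{k\ge0:\alpha_{k+1}\beta_{k+1}=0\}$. gLSQR iterates: $x_0=\mathbf{0}$, and for $1\le k\le k_t$, $$x_k=V_kB_k^{\dagger}\beta_1e_1,$$ where $V_k=(v_1,\dots,v_k)\in\mathbb{R}^{n\times k}$, $e_1$ is the first column of $I_{k+1}$, and $B_k\in\mathbb{R}^{(k+1)\times k}$ is the lower bidiagonal matrix with diagonal entries $(B_k)_{ii}=\alpha_i$ $(1\le i\le k)$ and subdiagonal entries $(B_k)_{i+1,i}=\beta_{i+1}$ $(1\le i\le k)$. *)

theory Defs
  imports Complex_Main "Jordan_Normal_Form.Matrix"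
begin

definition is_pinv :: "real mat \<Rightarrow> real mat \<Rightarrow> bool" where
  "is_pinv M X \<longleftrightarrow> X \<in> carrier_mat (dim_col M) (dim_row M)
     \<and> M * X * M = M \<and> X * M * X = X
     \<and> transpose_mat (M * X) = M * X \<and> transpose_mat (X * M) = X * M"

text \<open>The Moore-Penrose pseudoinverse, as the unique matrix satisfying the four Penrose conditions.\<close>

definition pinv :: "real mat \<Rightarrow> real mat" where
  "pinv M = (THE X. is_pinv M X)"

definition sym_psd :: "nat \<Rightarrow> real mat \<Rightarrow> bool" where
  "sym_psd n C \<longleftrightarrow> C \<in> carrier_mat n n \<and> transpose_mat C = C
     \<and> (\<forall>x \<in> carrier_vec n. 0 \<le> x \<bullet> (C *\<^sub>v x))"

definition wnorm :: "real mat \<Rightarrow> real vec \<Rightarrow> real" where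
  "wnorm C x = sqrt (x \<bullet> (C *\<^sub>v x))"

definition norm2 :: "real vec \<Rightarrow> real" where
  "norm2 x = sqrt (x \<bullet> x)"

definition wnormalize :: "real mat \<Rightarrow> real vec \<Rightarrow> real vec" where
  "wnormalize C x =
     (if wnorm C x = 0 then 0\<^sub>v (dim_vec x) else (1 / wnorm C x) \<cdot>\<^sub>v x)"


definition ls_minimizers :: "real mat \<Rightarrow> real mat \<Rightarrow> real vec \<Rightarrow> real vec set" where
  "ls_minimizers A P b =
     {x. is_arg_min (\<lambda>y. wnorm P (A *\<^sub>v y - b)) (\<lambda>y. y \<in> carrier_vec (dim_col A)) x}"

definition gls_solutions :: "real mat \<Rightarrow> real mat \<Rightarrow> real mat \<Rightarrow> real vec \<Rightarrow> real vec set" where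
  "gls_solutions A P Q b = {x. is_arg_min (wnorm Q) (\<lambda>y. y \<in> ls_minimizers A P b) x}"

definition is_min_norm_gls_solution ::
    "real mat \<Rightarrow> real mat \<Rightarrow> real mat \<Rightarrow> real vec \<Rightarrow> real vec \<Rightarrow> bool" where
  "is_min_norm_gls_solution A P Q b x \<longleftrightarrow>
     x \<in> gls_solutions A P Q b \<and> (\<forall>y \<in> gls_solutions A P Q b. y \<noteq> x \<longrightarrow> norm2 x < norm2 y)"


definition Gmat :: "real mat \<Rightarrow> real mat \<Rightarrow> real mat \<Rightarrow> real mat" where
  "Gmat A P Q = transpose_mat A * P * A + Q"

text \<open>\<open>u_rhs i\<close> and \<open>v_rhs i\<close> are the right-hand sides \<open>\<beta>\<^sub>i u\<^sub>i\<close> and \<open>\<alpha>\<^sub>i v\<^sub>i\<close> of the gGKB recurrences;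
  the scalars are their seminorms and the vectors their normalizations. Indices start at 1 as in
  the recurrences: \<open>v_rhs 0\<close> encodes \<open>v\<^sub>0 = 0\<close>, while \<open>u_rhs 0\<close> is never used.
  Past the termination step the recurrences are not cut off; no value there is used except
  \<open>\<alpha>\<close> and \<open>\<beta>\<close> at the index right after it, where the process itself defines them.\<close>

context
  fixes A P Q :: "real mat" and b :: "real vec"
begin

function u_rhs :: "nat \<Rightarrow> real vec" and v_rhs :: "nat \<Rightarrow> real vec" where
  "u_rhs 0 = 0\<^sub>v (dim_row A)"
| "u_rhs (Suc 0) = (P * pinv P) *\<^sub>v b"
| "u_rhs (Suc (Suc i)) =
     (P * pinv P * A) *\<^sub>v wnormalize (Gmat A P Q) (v_rhs (Suc i))
       - wnorm (Gmat A P Q) (v_rhs (Suc i)) \<cdot>\<^sub>v wnormalize P (u_rhs (Suc i))"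
| "v_rhs 0 = 0\<^sub>v (dim_col A)"
| "v_rhs (Suc i) =
     (pinv (Gmat A P Q) * transpose_mat A * P) *\<^sub>v wnormalize P (u_rhs (Suc i))
       - wnorm P (u_rhs (Suc i)) \<cdot>\<^sub>v wnormalize (Gmat A P Q) (v_rhs i)"
  by pat_completeness auto
termination
  by (relation "measure (case_sum (\<lambda>i. 2 * i) (\<lambda>i. 2 * i + 1))") auto

definition ggkb_beta :: "nat \<Rightarrow> real" where
  "ggkb_beta i = wnorm P (u_rhs i)"

definition ggkb_u :: "nat \<Rightarrow> real vec" where
  "ggkb_u i = wnormalize P (u_rhs i)"

definition ggkb_alpha :: "nat \<Rightarrow> real" where
  "ggkb_alpha i = wnorm (Gmat A P Q) (v_rhs i)"

definition ggkb_v :: "nat \<Rightarrow> real vec" where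
  "ggkb_v i = wnormalize (Gmat A P Q) (v_rhs i)"

definition ggkb_terminates_at :: "nat \<Rightarrow> bool" where
  "ggkb_terminates_at k \<longleftrightarrow> ggkb_alpha (k + 1) * ggkb_beta (k + 1) = 0
     \<and> (\<forall>j < k. ggkb_alpha (j + 1) * ggkb_beta (j + 1) \<noteq> 0)"

text \<open>Matrix entries are indexed from 0, the gGKB scalars from 1.\<close>

definition Bmat :: "nat \<Rightarrow> real mat" where
  "Bmat k = mat (k + 1) k (\<lambda>(i, j).
     if i = j then ggkb_alpha (j + 1)
     else if i = j + 1 then ggkb_beta (j + 2)
     else 0)"

definition Vmat :: "nat \<Rightarrow> real mat" where
  "Vmat k = mat_of_cols (dim_col A) (map ggkb_v [1..<k + 1])"

definition glsqr :: "nat \<Rightarrow> real vec" where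
  "glsqr k = (if k = 0 then 0\<^sub>v (dim_col A)
     else Vmat k *\<^sub>v (pinv (Bmat k) *\<^sub>v (ggkb_beta 1 \<cdot>\<^sub>v unit_vec (k + 1) 0)))"

end

text \<open>The recurrences in terms of the scalars and vectors of the process.\<close>

lemma u_rhs_Suc_Suc:
  "u_rhs A P Q b (Suc (Suc i)) =
     (P * pinv P * A) *\<^sub>v ggkb_v A P Q b (Suc i) - ggkb_alpha A P Q b (Suc i) \<cdot>\<^sub>v ggkb_u A P Q b (Suc i)"
  by (simp add: ggkb_v_def ggkb_alpha_def ggkb_u_def)

lemma v_rhs_Suc:
  "v_rhs A P Q b (Suc i) =
     (pinv (Gmat A P Q) * transpose_mat A * P) *\<^sub>v ggkb_u A P Q b (Suc i)
       - ggkb_beta A P Q b (Suc i) \<cdot>\<^sub>v ggkb_v A P Q b i"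
  by (simp add: ggkb_v_def ggkb_beta_def ggkb_u_def)

end

theory Submission
  imports Defs
begin

text \<open>The final iterate \<open>x = V\<^sub>k B\<^sub>k\<^sup>\<dagger> \<beta>\<^sub>1 e\<^sub>1\<close> is characterized by three linear conditions. The recurrences give
  \<open>P P\<^sup>\<dagger> A V\<^sub>k = U\<^sub>k\<^sub>+\<^sub>1 B\<^sub>k\<close> and, because the next \<open>v\<close>-vector vanishes at termination,
  \<open>G\<^sup>\<dagger> A\<^sup>T P U\<^sub>k\<^sub>+\<^sub>1 = V\<^sub>k B\<^sub>k\<^sup>T\<close>; so the normal equations of the small bidiagonal problem lift to
  \<open>A\<^sup>T P (A x - b) = 0\<close>. By induction every \<open>G v\<^sub>i\<close> lies in the range of \<open>A\<^sup>T P\<close>, so \<open>G x\<close>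
  is orthogonal to \<open>ker (P A)\<close>, on which \<open>G\<close> and \<open>Q\<close> agree: this is optimality for the
  \<open>Q\<close>-seminorm. Finally every \<open>v\<^sub>i\<close> lies in the range of \<open>G\<^sup>\<dagger>\<close>, so \<open>x\<close> is orthogonal to
  \<open>ker G = ker (P A) \<inter> ker Q\<close>, which gives minimality of the Euclidean norm. The orthonormality
  of the \<open>u\<^sub>i\<close> and \<open>v\<^sub>i\<close> plays no role.\<close>

subsection \<open>The pseudoinverse of a real matrix\<close>

lemma scalar_prod_self_ge_0: "0 \<le> v \<bullet> (v :: real vec)"
  by (simp add: scalar_prod_def sum_nonneg)

lemma scalar_prod_self_eq_0_iff:
  assumes "(v :: real vec) \<in> carrier_vec n"
  shows "v \<bullet> v = 0 \<longleftrightarrow> v = 0\<^sub>v n"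
  using assms by (auto simp: scalar_prod_def sum_nonneg_eq_0_iff)

text \<open>Gram-Schmidt step: the new column is first made orthogonal to the previous ones.\<close>

lemma ex_residual_orthogonal_cols:
  assumes M: "(M :: real mat) \<in> carrier_mat m n" and c: "c \<in> carrier_vec m" and "k \<le> n"
  shows "\<exists>y \<in> carrier_vec n. (\<forall>i<k. col M i \<bullet> (c - M *\<^sub>v y) = 0) \<and> (\<forall>i<n. k \<le> i \<longrightarrow> y $ i = 0)"
  using c \<open>k \<le> n\<close>
proof (induction k arbitrary: c)
  case 0
  then show ?case by (intro bexI[of _ "0\<^sub>v n"]) auto
next
  case (Suc k)
  define a where "a = col M k"
  have k: "k < n" using Suc.prems by simp
  have a: "a \<in> carrier_vec m" using M k by (auto simp: a_def)
  obtain ya where ya: "ya \<in> carrier_vec n" and ya_orth: "\<And>i. i < k \<Longrightarrow> col M i \<bullet> (a - M *\<^sub>v ya) = 0"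
    and ya_supp: "\<And>i. i < n \<Longrightarrow> k \<le> i \<Longrightarrow> ya $ i = 0"
    using Suc.IH[OF a] k by auto
  obtain yc where yc: "yc \<in> carrier_vec n" and yc_orth: "\<And>i. i < k \<Longrightarrow> col M i \<bullet> (c - M *\<^sub>v yc) = 0"
    and yc_supp: "\<And>i. i < n \<Longrightarrow> k \<le> i \<Longrightarrow> yc $ i = 0"
    using Suc.IH[OF Suc.prems(1)] k by auto
  define a' where "a' = a - M *\<^sub>v ya"
  define r where "r = c - M *\<^sub>v yc"
  \<comment> \<open>The coefficient of \<open>r\<close> along \<open>a'\<close>. If column
    \<open>k\<close> depends on the earlier ones, then \<open>a' = 0\<close>, the quotient is 0, and
    nothing has to be removed.\<close>
  define t where "t = a' \<bullet> r / (a' \<bullet> a')"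
  define y where "y = yc + t \<cdot>\<^sub>v (unit_vec n k - ya)"
  have a': "a' \<in> carrier_vec m" and r: "r \<in> carrier_vec m"
    using M ya yc a Suc.prems by (auto simp: a'_def r_def)
  have y: "y \<in> carrier_vec n" using yc ya by (auto simp: y_def)
  have Mk: "M *\<^sub>v unit_vec n k = a" using M k by (intro eq_vecI) (auto simp: a_def)
  have My: "M *\<^sub>v y = M *\<^sub>v yc + t \<cdot>\<^sub>v a'"
    unfolding y_def a'_def
    using M ya yc Mk
    by (simp add: mult_add_distrib_mat_vec[of _ m n] mult_mat_vec[of _ m n] mult_minus_distrib_mat_vec[of _ m n])
  have res: "c - M *\<^sub>v y = r - t \<cdot>\<^sub>v a'"
    unfolding My r_def using M Suc.prems(1) yc a' by (intro eq_vecI) auto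
  have orth: "w \<bullet> (r - t \<cdot>\<^sub>v a') = w \<bullet> r - t * (w \<bullet> a')" if "w \<in> carrier_vec m" for w
    using that r a' by (simp add: scalar_prod_minus_distrib[of _ m])
  have colM: "col M i \<in> carrier_vec m" for i using M by auto
  have "col M i \<bullet> (c - M *\<^sub>v y) = 0" if "i < k" for i
    unfolding res using orth[OF colM, of i] that k ya_orth[of i] yc_orth[of i] by (simp add: a'_def r_def)
  moreover have "col M k \<bullet> (c - M *\<^sub>v y) = 0"
  proof -
    \<comment> \<open>\<open>ya\<close> is supported below \<open>k\<close>, so its image under
      \<open>M\<close> combines earlier columns only.\<close>
    have 1: "(M *\<^sub>v ya) \<bullet> w = 0" if w: "w \<in> carrier_vec m" and "\<And>i. i < k \<Longrightarrow> col M i \<bullet> w = 0" for w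
    proof -
      have "(M *\<^sub>v ya) \<bullet> w = w \<bullet> (M *\<^sub>v ya)" using M ya w by (simp add: comm_scalar_prod[of _ m])
      also have "\<dots> = (transpose_mat M *\<^sub>v w) \<bullet> ya"
        using transpose_vec_mult_scalar[OF M ya w] by simp
      also have "\<dots> = (\<Sum>i<n. (col M i \<bullet> w) * ya $ i)"
        using M ya w by (auto simp: scalar_prod_def lessThan_atLeast0)
      also have "\<dots> = 0"
        by (rule sum.neutral) (use that ya_supp in \<open>auto simp: not_less\<close>, meson not_le)
      finally show ?thesis .
    qed
    have "a = M *\<^sub>v ya + a'" unfolding a'_def using M ya a by (intro eq_vecI) auto
    then have "a \<bullet> w = (M *\<^sub>v ya) \<bullet> w + a' \<bullet> w" if "w \<in> carrier_vec m" for w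
      using that M ya a' by (metis add_scalar_prod_distrib mult_mat_vec_carrier)
    then have "a \<bullet> (r - t \<cdot>\<^sub>v a') = a' \<bullet> (r - t \<cdot>\<^sub>v a')"
      using 1[OF r] 1[OF a'] yc_orth ya_orth orth[of "M *\<^sub>v ya"] r a' M ya
      by (simp add: r_def[symmetric] a'_def[symmetric])
    also have "\<dots> = a' \<bullet> r - t * (a' \<bullet> a')" using orth a' by simp
    also have "\<dots> = 0"
      using scalar_prod_self_eq_0_iff[OF a'] r by (cases "a' \<bullet> a' = 0") (auto simp: t_def)
    finally show ?thesis by (simp add: res a_def)
  qed
  ultimately have "\<forall>i<Suc k. col M i \<bullet> (c - M *\<^sub>v y) = 0" by (auto simp: less_Suc_eq)
  moreover have "\<forall>i<n. Suc k \<le> i \<longrightarrow> y $ i = 0"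
    using ya yc k ya_supp yc_supp by (auto simp: y_def)
  ultimately show ?case using y by blast
qed

text \<open>Using all \<open>n\<close> columns, orthogonality of the residual says M^T (c - M y) =
  0. The solutions for the unit vectors \<open>c\<close> form the columns of
  \<open>Y\<close>.\<close>

lemma ex_normal_equations:
  assumes M: "(M :: real mat) \<in> carrier_mat m n"
  shows "\<exists>Y \<in> carrier_mat n m. transpose_mat M * M * Y = transpose_mat M"
proof -
  have "\<exists>y \<in> carrier_vec n. transpose_mat M *\<^sub>v (M *\<^sub>v y) = transpose_mat M *\<^sub>v c" if c: "c \<in> carrier_vec m" for c
  proof -
    obtain y where y: "y \<in> carrier_vec n" and orth: "\<forall>i<n. col M i \<bullet> (c - M *\<^sub>v y) = 0"
      using ex_residual_orthogonal_cols[OF M c order.refl] by auto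
    have "(transpose_mat M *\<^sub>v (M *\<^sub>v y)) $ i = (transpose_mat M *\<^sub>v c) $ i" if "i < n" for i
      using that orth M c y by (simp add: scalar_prod_minus_distrib[of _ m])
    then have "transpose_mat M *\<^sub>v (M *\<^sub>v y) = transpose_mat M *\<^sub>v c"
      using M by (intro eq_vecI) auto
    with y show ?thesis by blast
  qed
  then obtain f where f: "\<And>c. c \<in> carrier_vec m \<Longrightarrow> f c \<in> carrier_vec n"
    and f_eq: "\<And>c. c \<in> carrier_vec m \<Longrightarrow> transpose_mat M *\<^sub>v (M *\<^sub>v f c) = transpose_mat M *\<^sub>v c"
    by metis
  define Y where "Y = mat_of_cols n (map (\<lambda>j. f (unit_vec m j)) [0..<m])"
  have Y: "Y \<in> carrier_mat n m" using mat_of_cols_carrier(1)[of n "map (\<lambda>j. f (unit_vec m j)) [0..<m]"]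
    by (simp add: Y_def)
  have "col (transpose_mat M * M * Y) j = col (transpose_mat M) j" if j: "j < m" for j
  proof -
    have "col Y j = f (unit_vec m j)"
      unfolding Y_def using j f by (subst col_mat_of_cols) auto
    then have "col (transpose_mat M * M * Y) j = transpose_mat M *\<^sub>v (M *\<^sub>v f (unit_vec m j))"
      using M Y j f by (subst col_mult2[of _ n n _ m]) (auto simp: assoc_mult_mat_vec[of _ n m _ n])
    also have "\<dots> = transpose_mat M *\<^sub>v unit_vec m j" using f_eq by simp
    also have "\<dots> = col (transpose_mat M) j" using M j by (intro eq_vecI) auto
    finally show ?thesis .
  qed
  then have "transpose_mat M * M * Y = transpose_mat M"
    using M Y by (intro mat_col_eqI) auto
  with Y show ?thesis by blast
qed

text \<open>Multiplying the normal equations by Y^T gives (M Y)^T = (M Y)^T (M Y), whose right side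
  is symmetric; so \<open>M * Y\<close> is symmetric. Transposing the normal equations then gives
  the other claim.\<close>

lemma ex_pinv13:
  assumes M: "(M :: real mat) \<in> carrier_mat m n"
  shows "\<exists>Y \<in> carrier_mat n m. transpose_mat (M * Y) = M * Y \<and> M * Y * M = M"
proof -
  obtain Y where Y: "Y \<in> carrier_mat n m" and eq: "transpose_mat M * M * Y = transpose_mat M"
    using ex_normal_equations[OF M] by blast
  have MY: "M * Y \<in> carrier_mat m m" and MT: "transpose_mat M \<in> carrier_mat n m"
    and YT: "transpose_mat Y \<in> carrier_mat m n" using M Y by auto
  have "transpose_mat (M * Y) = transpose_mat Y * (transpose_mat M * M * Y)"
    using transpose_mult[OF M Y] eq by simp
  also have "\<dots> = (transpose_mat Y * transpose_mat M) * (M * Y)"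
    using assoc_mult_mat[OF MT M Y] assoc_mult_mat[OF YT MT MY] by simp
  also have "\<dots> = transpose_mat (M * Y) * (M * Y)" using transpose_mult[OF M Y] by simp
  finally have 1: "transpose_mat (M * Y) = transpose_mat (M * Y) * (M * Y)" .
  have "M * Y = transpose_mat (transpose_mat (M * Y) * (M * Y))" using 1 by (metis transpose_transpose)
  also have "\<dots> = transpose_mat (M * Y) * (M * Y)"
    using transpose_mult[of "transpose_mat (M * Y)" m m "M * Y" m] MY by simp
  finally have sym: "transpose_mat (M * Y) = M * Y" using 1 by simp
  have "M = transpose_mat (transpose_mat M * (M * Y))"
    using eq assoc_mult_mat[OF MT M Y] by simp
  also have "\<dots> = M * Y * M" using transpose_mult[OF MT MY] sym by simp
  finally show ?thesis using Y sym by auto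
qed

text \<open>If \<open>Y\<close> satisfies Penrose conditions 1 and 3 and \<open>Z\<close> satisfies 1 and 4, then \<open>Z M Y\<close> satisfies all four.\<close>

lemma ex_is_pinv: "\<exists>X. is_pinv M X"
proof -
  define m n where "m = dim_row M" and "n = dim_col M"
  have M: "M \<in> carrier_mat m n" by (simp add: m_def n_def)
  then have MT: "transpose_mat M \<in> carrier_mat n m" by simp
  obtain Y where Y: "Y \<in> carrier_mat n m" and Ysym: "transpose_mat (M * Y) = M * Y" and Yin: "M * Y * M = M"
    using ex_pinv13[OF M] by blast
  obtain W where W: "W \<in> carrier_mat m n" and Wsym: "transpose_mat (transpose_mat M * W) = transpose_mat M * W"
    and Win: "transpose_mat M * W * transpose_mat M = transpose_mat M"
    using ex_pinv13[OF MT] by blast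
  \<comment> \<open>Conditions 1 and 3 for the transpose with \<open>W\<close> turn into conditions
    1 and 4 for \<open>M\<close> with \<open>Z\<close>.\<close>
  define Z where "Z = transpose_mat W"
  have Z: "Z \<in> carrier_mat n m" using W by (simp add: Z_def)
  have ZM: "Z * M = transpose_mat M * W"
    using Wsym transpose_mult[OF MT W] by (simp add: Z_def)
  have "M = transpose_mat (transpose_mat M * W * transpose_mat M)" using Win by simp
  also have "\<dots> = M * (Z * M)"
    using transpose_mult[of "transpose_mat M * W" n n "transpose_mat M" m] MT W Wsym ZM by simp
  finally have Zin: "M * (Z * M) = M" ..
  have Zsym: "transpose_mat (Z * M) = Z * M" using Wsym ZM by simp
  define X where "X = Z * M * Y"
  have X: "X \<in> carrier_mat n m" using Z M Y by (simp add: X_def)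
  have ZMc: "Z * M \<in> carrier_mat n n" and MYc: "M * Y \<in> carrier_mat m m" using Z M Y by auto
  have MX: "M * X = M * Y"
    unfolding X_def using assoc_mult_mat[OF M ZMc Y] Zin by simp
  have XM: "X * M = Z * M"
    unfolding X_def using assoc_mult_mat[OF ZMc Y M] assoc_mult_mat[OF Z M] assoc_mult_mat[OF M Y M] Yin Y M
    by (metis mult_carrier_mat)
  have "X * M * X = Z * (M * X)" using XM assoc_mult_mat[OF Z M X] by simp
  also have "\<dots> = X" using MX assoc_mult_mat[OF Z M Y] by (simp add: X_def)
  finally have "X * M * X = X" .
  then have "is_pinv M X"
    unfolding is_pinv_def using X MX XM Ysym Yin Zsym by (simp add: m_def n_def)
  then show ?thesis ..
qed

text \<open>\<open>M * X\<close> and \<open>M * X'\<close> are symmetric projections onto the same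
  range, hence equal; likewise \<open>X * M = X' * M\<close>. Then X = X M X = X M X' = X' M X' =
  X'.\<close>

lemma is_pinv_unique:
  assumes "is_pinv M X" and "is_pinv M X'"
  shows "X = X'"
proof -
  define m n where "m = dim_row M" and "n = dim_col M"
  have M: "M \<in> carrier_mat m n" by (simp add: m_def n_def)
  have X: "X \<in> carrier_mat n m" "M * X * M = M" "X * M * X = X"
      "transpose_mat (M * X) = M * X" "transpose_mat (X * M) = X * M"
    and X': "X' \<in> carrier_mat n m" "M * X' * M = M" "X' * M * X' = X'"
      "transpose_mat (M * X') = M * X'" "transpose_mat (X' * M) = X' * M"
    using assms by (auto simp: is_pinv_def m_def n_def)
  note am = assoc_mult_mat
  have MX: "M * X \<in> carrier_mat m m" "M * X' \<in> carrier_mat m m"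
    and XM: "X * M \<in> carrier_mat n n" "X' * M \<in> carrier_mat n n" using M X(1) X'(1) by auto
  have "M * X = (M * X') * (M * X)"
    using am[OF MX(2) M X(1)] X'(2) by simp
  also have "\<dots> = transpose_mat ((M * X) * (M * X'))"
    using transpose_mult[OF MX] X(4) X'(4) by simp
  also have "\<dots> = M * X'" using am[OF MX(1) M X'(1)] X(2) X'(4) by simp
  finally have 1: "M * X = M * X'" .
  have "X * M = (X * M) * (X' * M)"
    using am[OF X(1) M XM(2)] am[OF M X'(1) M] X'(2) by simp
  also have "\<dots> = transpose_mat ((X' * M) * (X * M))"
    using transpose_mult[OF XM(2) XM(1)] X(5) X'(5) by simp
  also have "\<dots> = X' * M"
    using am[OF X'(1) M XM(1)] am[OF M X(1) M] X(2) X'(5) by simp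
  finally have 2: "X * M = X' * M" .
  have "X = X * (M * X')" using X(3) am[OF X(1) M X(1)] 1 by simp
  also have "\<dots> = X'" using am[OF X(1) M X'(1)] 2 X'(3) by simp
  finally show ?thesis .
qed

lemma is_pinv_pinv: "is_pinv M (pinv M)"
  unfolding pinv_def using ex_is_pinv is_pinv_unique by (metis theI)

text \<open>The transposed first Penrose condition. It makes \<open>pinv M\<close> applied to a
  vector solve the normal equations.\<close>

lemma transpose_mult_mult_pinv:
  assumes M: "M \<in> carrier_mat m n"
  shows "transpose_mat M * (M * pinv M) = transpose_mat M"
proof -
  have "transpose_mat M * (M * pinv M) = transpose_mat (M * pinv M * M)"
    using is_pinv_pinv[of M] M by (subst transpose_mult[of _ m m _ n]) (auto simp: is_pinv_def)
  then show ?thesis using is_pinv_pinv[of M] by (simp add: is_pinv_def)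
qed

lemma pinv_carrier [simp]: "M \<in> carrier_mat m n \<Longrightarrow> pinv M \<in> carrier_mat n m"
  using is_pinv_pinv[of M] by (auto simp: is_pinv_def)

subsection \<open>Positive semidefinite forms\<close>

lemma smult_zero_vec_right [simp]: "a \<cdot>\<^sub>v 0\<^sub>v n = (0\<^sub>v n :: real vec)"
  by (intro eq_vecI) auto

lemma mult_mat_zero_vec: "(M :: real mat) \<in> carrier_mat nr nc \<Longrightarrow> M *\<^sub>v 0\<^sub>v nc = 0\<^sub>v nr"
  by (intro eq_vecI) auto

lemma mult_unit_vec:
  assumes "(M :: real mat) \<in> carrier_mat nr nc" "j < nc"
  shows "M *\<^sub>v unit_vec nc j = col M j"
  using assms by (intro eq_vecI) auto

lemma minus_vec_eq_zeroD:
  assumes "v \<in> carrier_vec n" "w \<in> carrier_vec n" and eq: "v - w = (0\<^sub>v n :: real vec)"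
  shows "v = w"
proof (rule eq_vecI)
  fix i assume i: "i < dim_vec w"
  then have "v $ i - w $ i = (v - w) $ i" by simp
  also have "\<dots> = 0" unfolding eq using i assms(2) by simp
  finally show "v $ i = w $ i" by simp
qed (use assms in auto)

lemma symmetric_scalar_prod:
  assumes "(C :: real mat) \<in> carrier_mat n n" "transpose_mat C = C" "x \<in> carrier_vec n" "y \<in> carrier_vec n"
  shows "x \<bullet> (C *\<^sub>v y) = (C *\<^sub>v x) \<bullet> y"
  using transpose_vec_mult_scalar[of C n n y x] assms by simp

text \<open>Pythagoras; applied with \<open>P\<close>, \<open>Q\<close> and the identity, one for
  each of the three nested minimizations.\<close>

lemma quadratic_form_add:
  assumes C: "(C :: real mat) \<in> carrier_mat n n" "transpose_mat C = C"
    and x: "x \<in> carrier_vec n" and d: "d \<in> carrier_vec n" and orth: "d \<bullet> (C *\<^sub>v x) = 0"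
  shows "(x + d) \<bullet> (C *\<^sub>v (x + d)) = x \<bullet> (C *\<^sub>v x) + d \<bullet> (C *\<^sub>v d)"
proof -
  have "x \<bullet> (C *\<^sub>v d) = (C *\<^sub>v x) \<bullet> d" using symmetric_scalar_prod[OF C x d] .
  also have "\<dots> = 0" using orth C x d comm_scalar_prod[of "C *\<^sub>v x" n d] by simp
  finally have "x \<bullet> (C *\<^sub>v d) = 0" .
  with orth C x d show ?thesis
    by (simp add: mult_add_distrib_mat_vec[of _ n n] scalar_prod_add_distrib[of _ n]
        add_scalar_prod_distrib[of _ n])
qed

text \<open>Otherwise a small negative step from \<open>x\<close> along \<open>C x\<close> would
  make the form negative, because the first-order term dominates.\<close>

lemma sym_psd_form_eq_0:
  assumes C: "sym_psd n C" and x: "x \<in> carrier_vec n" and zero: "x \<bullet> (C *\<^sub>v x) = 0"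
  shows "C *\<^sub>v x = 0\<^sub>v n"
proof (rule ccontr)
  assume neq: "C *\<^sub>v x \<noteq> 0\<^sub>v n"
  have Cc: "C \<in> carrier_mat n n" and sym: "transpose_mat C = C"
    and psd: "\<And>z. z \<in> carrier_vec n \<Longrightarrow> 0 \<le> z \<bullet> (C *\<^sub>v z)"
    using C by (auto simp: sym_psd_def)
  define w s q where "w = C *\<^sub>v x" and "s = w \<bullet> w" and "q = w \<bullet> (C *\<^sub>v w)"
  have w: "w \<in> carrier_vec n" using Cc x by (simp add: w_def)
  have s: "s > 0" using neq scalar_prod_self_eq_0_iff[OF w] scalar_prod_self_ge_0[of w]
    by (auto simp: s_def w_def)
  have q: "q \<ge> 0" using psd w by (simp add: q_def)
  have xw: "x \<bullet> (C *\<^sub>v w) = s"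
    using symmetric_scalar_prod[OF Cc sym x w] by (simp add: s_def w_def)
  have form: "(x + t \<cdot>\<^sub>v w) \<bullet> (C *\<^sub>v (x + t \<cdot>\<^sub>v w)) = t * (2 * s + t * q)" for t
  proof -
    have "C *\<^sub>v (x + t \<cdot>\<^sub>v w) = w + t \<cdot>\<^sub>v (C *\<^sub>v w)"
      using Cc x w by (simp add: mult_add_distrib_mat_vec[of _ n n] mult_mat_vec[of _ n n] w_def)
    then show ?thesis
      using Cc x w zero xw
      by (simp add: scalar_prod_add_distrib[of _ n] add_scalar_prod_distrib[of _ n]
          q_def[symmetric] s_def[symmetric] w_def[symmetric] algebra_simps)
  qed
  \<comment> \<open>Adding 1 keeps the denominator positive if \<open>q = 0\<close>, and still
    \<open>2 * s + t * q\<close> is at least \<open>s\<close>.\<close>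
  define t where "t = - s / (q + 1)"
  have "t < 0" using s q by (simp add: t_def)
  moreover have "2 * s + t * q > 0" 
  proof -
    have "s * q / (q + 1) \<le> s" using s q by (simp add: field_simps)
    then show ?thesis using s by (simp add: t_def)
  qed
  ultimately have "t * (2 * s + t * q) < 0" by (rule mult_neg_pos)
  moreover have "0 \<le> t * (2 * s + t * q)" using psd[of "x + t \<cdot>\<^sub>v w"] x w form[of t] by simp
  ultimately show False by simp
qed

lemma wnorm_eq_0:
  assumes "sym_psd n C" "x \<in> carrier_vec n" "wnorm C x = 0"
  shows "C *\<^sub>v x = 0\<^sub>v n"
  using assms sym_psd_form_eq_0 by (simp add: wnorm_def)

lemma wnormalize_carrier [simp]: "x \<in> carrier_vec n \<Longrightarrow> wnormalize C x \<in> carrier_vec n"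
  by (auto simp: wnormalize_def)

lemma scalar_prod_wnormalize_eq_0:
  assumes "y \<in> carrier_vec n" "x \<in> carrier_vec n" "y \<bullet> x = 0"
  shows "y \<bullet> wnormalize C x = 0"
  using assms by (auto simp: wnormalize_def)

text \<open>For semidefinite \<open>C\<close>, seminorm zero only gives C x = 0. Since
  \<open>x\<close> is orthogonal to the kernel of \<open>C\<close>, it is then orthogonal to itself
  and vanishes.\<close>

lemma wnorm_smult_wnormalize:
  assumes "sym_psd n C" and x: "x \<in> carrier_vec n"
    and perp: "\<And>y. y \<in> carrier_vec n \<Longrightarrow> C *\<^sub>v y = 0\<^sub>v n \<Longrightarrow> y \<bullet> x = 0"
  shows "wnorm C x \<cdot>\<^sub>v wnormalize C x = x"
proof (cases "wnorm C x = 0")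
  case True
  then have "x \<bullet> x = 0" using perp x wnorm_eq_0[OF assms(1) x] by blast
  then have "x = 0\<^sub>v n" using scalar_prod_self_eq_0_iff[OF x] by simp
  with True show ?thesis by (simp add: wnormalize_def)
next
  case False
  then show ?thesis by (simp add: wnormalize_def smult_smult_assoc)
qed

subsection \<open>The gGKB relations\<close>

locale ggkb_problem =
  fixes m n :: nat and A P Q :: "real mat" and b :: "real vec"
  assumes A [simp]: "A \<in> carrier_mat m n"
    and P_psd: "sym_psd m P" and Q_psd: "sym_psd n Q"
    and b [simp]: "b \<in> carrier_vec m"
begin

abbreviation "G \<equiv> Gmat A P Q"
abbreviation "AT \<equiv> transpose_mat A"
abbreviation "\<alpha> \<equiv> ggkb_alpha A P Q b"
abbreviation "\<beta> \<equiv> ggkb_beta A P Q b"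
abbreviation "u \<equiv> ggkb_u A P Q b"
abbreviation "v \<equiv> ggkb_v A P Q b"
abbreviation "u\<^sub>r \<equiv> u_rhs A P Q b"
abbreviation "v\<^sub>r \<equiv> v_rhs A P Q b"
abbreviation "H \<equiv> pinv G * AT * P"

lemma P [simp]: "P \<in> carrier_mat m m" and P_sym: "transpose_mat P = P"
  and Q [simp]: "Q \<in> carrier_mat n n" and Q_sym: "transpose_mat Q = Q"
  using P_psd Q_psd by (auto simp: sym_psd_def)

lemma AT [simp]: "AT \<in> carrier_mat n m"
  using A by simp

lemma ATP [simp]: "AT * P \<in> carrier_mat n m"
  by (rule mult_carrier_mat[OF AT P])

lemma ATPA [simp]: "AT * P * A \<in> carrier_mat n n"
  by (rule mult_carrier_mat[OF ATP A])

lemma G [simp]: "G \<in> carrier_mat n n"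
  by (simp add: Gmat_def)

lemmas pinv_P = pinv_carrier[OF P] and pinv_G = pinv_carrier[OF G]
lemmas PP [simp] = mult_carrier_mat[OF P pinv_P]
lemmas PPA [simp] = mult_carrier_mat[OF PP A]
lemmas H [simp] = mult_carrier_mat[OF mult_carrier_mat[OF pinv_G AT] P]

lemmas mult_vec_carriers [simp] =
  A[THEN mult_mat_vec_carrier] P[THEN mult_mat_vec_carrier] Q[THEN mult_mat_vec_carrier]
  AT[THEN mult_mat_vec_carrier] G[THEN mult_mat_vec_carrier] pinv_P[THEN mult_mat_vec_carrier]
  pinv_G[THEN mult_mat_vec_carrier] PP[THEN mult_mat_vec_carrier]
  PPA[THEN mult_mat_vec_carrier] H[THEN mult_mat_vec_carrier]

lemmas dims [simp] = carrier_matD[OF A] carrier_matD[OF P] carrier_matD[OF G]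
  carrier_matD[OF pinv_P] carrier_matD[OF pinv_G]

section \<open>Elementary properties of \<open>G\<close> and \<open>H\<close>\<close>

lemma scalar_prod_AT:
  assumes "x \<in> carrier_vec n" "y \<in> carrier_vec m"
  shows "x \<bullet> (AT *\<^sub>v y) = (A *\<^sub>v x) \<bullet> y"
  using transpose_vec_mult_scalar[OF AT assms(2,1)] by simp

lemma G_mult_vec: "x \<in> carrier_vec n \<Longrightarrow> G *\<^sub>v x = AT *\<^sub>v (P *\<^sub>v (A *\<^sub>v x)) + Q *\<^sub>v x"
  unfolding Gmat_def
  by (simp add: add_mult_distrib_mat_vec[OF ATPA Q] assoc_mult_mat_vec[OF ATP A]
      assoc_mult_mat_vec[OF AT P])

lemma H_mult_vec: "x \<in> carrier_vec m \<Longrightarrow> H *\<^sub>v x = pinv G *\<^sub>v (AT *\<^sub>v (P *\<^sub>v x))"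
  by (simp add: assoc_mult_mat_vec[OF mult_carrier_mat[OF pinv_G AT] P] assoc_mult_mat_vec[OF pinv_G AT])

lemma G_form: "x \<in> carrier_vec n \<Longrightarrow>
    x \<bullet> (G *\<^sub>v x) = (A *\<^sub>v x) \<bullet> (P *\<^sub>v (A *\<^sub>v x)) + x \<bullet> (Q *\<^sub>v x)"
  by (simp add: G_mult_vec scalar_prod_add_distrib[of _ n] scalar_prod_AT)

lemma G_psd: "sym_psd n G"
proof -
  have "transpose_mat (AT * P * A) = AT * (P * A)"
    using transpose_mult[OF ATP A] transpose_mult[OF AT P] P_sym by simp
  also have "\<dots> = AT * P * A" using assoc_mult_mat[OF AT P A] by simp
  finally have "transpose_mat G = G"
    unfolding Gmat_def using transpose_add[OF ATPA Q] Q_sym by simp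
  then show ?thesis
    using P_psd Q_psd by (simp add: sym_psd_def G_form)
qed

lemma G_sym: "transpose_mat G = G"
  using G_psd by (simp add: sym_psd_def)

text \<open>The form of \<open>G\<close> is a sum of two nonnegative forms, so both vanish at
  \<open>x\<close>.\<close>

lemma kernel_G_subset_kernel_PA:
  assumes x: "x \<in> carrier_vec n" and "G *\<^sub>v x = 0\<^sub>v n"
  shows "P *\<^sub>v (A *\<^sub>v x) = 0\<^sub>v m"
proof -
  have "(A *\<^sub>v x) \<bullet> (P *\<^sub>v (A *\<^sub>v x)) + x \<bullet> (Q *\<^sub>v x) = 0"
    using G_form[OF x] assms by simp
  moreover have "0 \<le> (A *\<^sub>v x) \<bullet> (P *\<^sub>v (A *\<^sub>v x))" "0 \<le> x \<bullet> (Q *\<^sub>v x)"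
    using P_psd Q_psd x by (auto simp: sym_psd_def)
  ultimately have "(A *\<^sub>v x) \<bullet> (P *\<^sub>v (A *\<^sub>v x)) = 0" by linarith
  then show ?thesis using sym_psd_form_eq_0[OF P_psd] x by simp
qed

text \<open>Lets recurrences for projected vectors speak about the unprojected residual.\<close>

lemma P_PP_vec: "x \<in> carrier_vec m \<Longrightarrow> P *\<^sub>v ((P * pinv P) *\<^sub>v x) = P *\<^sub>v x"
  using transpose_mult_mult_pinv[OF P] assoc_mult_mat_vec[OF P PP] by (simp add: P_sym)

text \<open>\<open>G G\<^sup>\<dagger>\<close> is the identity on the range of \<open>A\<^sup>T P\<close>, since \<open>ker G\<close> is contained in \<open>ker (P A)\<close>.\<close>

lemma G_H_vec:
  assumes x: "x \<in> carrier_vec m"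
  shows "G *\<^sub>v (H *\<^sub>v x) = AT *\<^sub>v (P *\<^sub>v x)"
proof -
  define w where "w = AT *\<^sub>v (P *\<^sub>v x)"
  define p where "p = pinv G *\<^sub>v w"
  \<comment> \<open>The defect \<open>d\<close> lies in the kernel of \<open>G\<close>, hence is
    orthogonal to the range of \<open>G\<close> and, by the kernel inclusion, to \<open>w\<close>;
    so it is orthogonal to itself.\<close>
  define d where "d = w - G *\<^sub>v p"
  have w: "w \<in> carrier_vec n" using mult_mat_vec_carrier[OF AT] x by (simp add: w_def)
  then have p: "p \<in> carrier_vec n" using mult_mat_vec_carrier[OF pinv_carrier[OF G]] by (simp add: p_def)
  have d: "d \<in> carrier_vec n" using mult_mat_vec_carrier[OF G p] w by (simp add: d_def)
  have "G *\<^sub>v (G *\<^sub>v p) = (G * (G * pinv G)) *\<^sub>v w"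
    using w assoc_mult_mat_vec[OF G mult_carrier_mat[OF G pinv_G] w] assoc_mult_mat_vec[OF G pinv_G w]
    by (simp add: p_def)
  then have "G *\<^sub>v (G *\<^sub>v p) = G *\<^sub>v w"
    using transpose_mult_mult_pinv[OF G] by (simp add: G_sym)
  then have Gd: "G *\<^sub>v d = 0\<^sub>v n"
    unfolding d_def using w p mult_mat_vec_carrier[OF G] by (simp add: mult_minus_distrib_mat_vec[of _ n n])
  have "d \<bullet> w = (P *\<^sub>v (A *\<^sub>v d)) \<bullet> x"
    unfolding w_def using d x scalar_prod_AT[OF d, of "P *\<^sub>v x"] symmetric_scalar_prod[OF P P_sym, of "A *\<^sub>v d" x]
    by simp
  then have dw: "d \<bullet> w = 0" using kernel_G_subset_kernel_PA[OF d Gd] x by simp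
  have dGp: "d \<bullet> (G *\<^sub>v p) = 0" using symmetric_scalar_prod[OF G G_sym d p] Gd p by simp
  have "d \<bullet> d = d \<bullet> w - d \<bullet> (G *\<^sub>v p)"
    using scalar_prod_minus_distrib[OF d w, of "G *\<^sub>v p"] p by (simp add: d_def[symmetric])
  then have "d = 0\<^sub>v n" using dw dGp scalar_prod_self_eq_0_iff[OF d] by simp
  then have "w = G *\<^sub>v p"
    using w mult_mat_vec_carrier[OF G p] minus_vec_eq_zeroD by (simp add: d_def)
  then show ?thesis using x by (simp add: H_mult_vec w_def p_def)
qed

section \<open>Dimensions and ranges of the gGKB vectors\<close>

lemma rhs_carrier [simp]: "u\<^sub>r i \<in> carrier_vec m" "v\<^sub>r i \<in> carrier_vec n"
proof -
  \<comment> \<open>A vector difference takes its dimension from the second operand, so neither of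
    the mutually recursive sequences needs the other here.\<close>
  have "dim_vec (v\<^sub>r i) = n" for i
    by (induction i) (simp_all add: wnormalize_def)
  then show v: "v\<^sub>r i \<in> carrier_vec n" for i by (rule carrier_vecI)
  have "dim_vec (u\<^sub>r i) = m" for i
    by (induction i rule: induct_nat_012) (simp_all add: wnormalize_def)
  then show "u\<^sub>r i \<in> carrier_vec m" by (rule carrier_vecI)
qed

lemma uv_carrier [simp]: "u i \<in> carrier_vec m" "v i \<in> carrier_vec n"
  by (simp_all add: ggkb_u_def ggkb_v_def)

text \<open>Each right-hand side stays in the range of \<open>P\<close>, which is orthogonal to the
  kernel by symmetry.\<close>

lemma kernel_P_perp_u_rhs:
  assumes y: "y \<in> carrier_vec m" and Py: "P *\<^sub>v y = 0\<^sub>v m"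
  shows "y \<bullet> u\<^sub>r i = 0"
proof -
  have range: "y \<bullet> ((P * pinv P) *\<^sub>v x) = 0" if x: "x \<in> carrier_vec m" for x
  proof -
    have px: "pinv P *\<^sub>v x \<in> carrier_vec m" using mult_mat_vec_carrier[OF pinv_carrier[OF P]] x by simp
    have "y \<bullet> ((P * pinv P) *\<^sub>v x) = (P *\<^sub>v y) \<bullet> (pinv P *\<^sub>v x)"
      using symmetric_scalar_prod[OF P P_sym y px] x by (simp add: assoc_mult_mat_vec[of _ m m _ m])
    then show ?thesis using Py px by simp
  qed
  show ?thesis
  proof (induction i rule: induct_nat_012)
    case (ge2 i)
    have "y \<bullet> u (Suc i) = 0"
      unfolding ggkb_u_def using ge2 y by (intro scalar_prod_wnormalize_eq_0) auto
    moreover have "y \<bullet> ((P * pinv P * A) *\<^sub>v v (Suc i)) = 0"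
      using range[of "A *\<^sub>v v (Suc i)"] by (simp add: assoc_mult_mat_vec[OF PP A])
    ultimately show ?case
      unfolding u_rhs_Suc_Suc using y mult_mat_vec_carrier[OF PPA]
      by (subst scalar_prod_minus_distrib[of _ m]) auto
  qed (use y range in auto)
qed

lemma kernel_G_perp_v_rhs:
  assumes y: "y \<in> carrier_vec n" and Gy: "G *\<^sub>v y = 0\<^sub>v n"
  shows "y \<bullet> v\<^sub>r i = 0"
proof -
  have range: "y \<bullet> (pinv G *\<^sub>v x) = 0" if x: "x \<in> carrier_vec n" for x
  proof -
    define p where "p = pinv G *\<^sub>v x"
    have p: "p \<in> carrier_vec n" using mult_mat_vec_carrier[OF pinv_carrier[OF G]] x by (simp add: p_def)
    have GG: "pinv G * G \<in> carrier_mat n n" by (rule mult_carrier_mat[OF pinv_G G])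
    \<comment> \<open>\<open>pinv G * G\<close> fixes the range of \<open>pinv G\<close>, is
      symmetric and annihilates \<open>y\<close>; so it can be inserted before \<open>p\<close> and
      moved over to \<open>y\<close>.\<close>
    have "p = (pinv G * G * pinv G) *\<^sub>v x" using is_pinv_pinv[of G] by (simp add: is_pinv_def p_def)
    also have "\<dots> = (pinv G * G) *\<^sub>v p" using assoc_mult_mat_vec[OF GG pinv_G x] by (simp add: p_def)
    finally have "y \<bullet> p = y \<bullet> ((pinv G * G) *\<^sub>v p)" by simp
    also have "\<dots> = ((pinv G * G) *\<^sub>v y) \<bullet> p"
      using is_pinv_pinv[of G] by (intro symmetric_scalar_prod[OF GG _ y p]) (simp add: is_pinv_def)
    also have "(pinv G * G) *\<^sub>v y = 0\<^sub>v n"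
      using assoc_mult_mat_vec[OF pinv_G G y] Gy mult_mat_zero_vec[OF pinv_G] by simp
    finally show ?thesis using p by (simp add: p_def)
  qed
  show ?thesis
  proof (induction i)
    case (Suc i)
    have "y \<bullet> v i = 0"
      unfolding ggkb_v_def using Suc y by (intro scalar_prod_wnormalize_eq_0) auto
    moreover have "y \<bullet> (H *\<^sub>v u (Suc i)) = 0"
      using range[of "AT *\<^sub>v (P *\<^sub>v u (Suc i))"] mult_mat_vec_carrier[OF AT] by (simp add: H_mult_vec)
    ultimately show ?case
      unfolding v_rhs_Suc using y mult_mat_vec_carrier[OF H]
      by (subst scalar_prod_minus_distrib[of _ n]) auto
  qed (use y in auto)
qed

text \<open>Undoes the normalization at every index, also where the scalar is zero and the vector
  was set to zero.\<close>

lemma beta_u: "\<beta> i \<cdot>\<^sub>v u i = u\<^sub>r i"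
  unfolding ggkb_beta_def ggkb_u_def
  by (rule wnorm_smult_wnormalize[OF P_psd]) (simp_all add: kernel_P_perp_u_rhs)

lemma alpha_v: "\<alpha> i \<cdot>\<^sub>v v i = v\<^sub>r i"
  unfolding ggkb_alpha_def ggkb_v_def
  by (rule wnorm_smult_wnormalize[OF G_psd]) (simp_all add: kernel_G_perp_v_rhs)

lemma kernel_G_perp_v:
  assumes "y \<in> carrier_vec n" "G *\<^sub>v y = 0\<^sub>v n"
  shows "y \<bullet> v i = 0"
  unfolding ggkb_v_def using assms kernel_G_perp_v_rhs by (intro scalar_prod_wnormalize_eq_0) auto

text \<open>By \<open>G_H_vec\<close>, \<open>G\<close> maps each new term \<open>H u\<close> to A^T
  P u, so inductively G v stays in the range of A^T P, which is orthogonal to the kernel of P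
  A.\<close>

lemma kernel_PA_perp_Gv:
  assumes z: "z \<in> carrier_vec n" and PAz: "P *\<^sub>v (A *\<^sub>v z) = 0\<^sub>v m"
  shows "(G *\<^sub>v z) \<bullet> v i = 0"
proof -
  have Gz: "G *\<^sub>v z \<in> carrier_vec n" using mult_mat_vec_carrier[OF G z] .
  have "(G *\<^sub>v z) \<bullet> v\<^sub>r i = 0"
  proof (induction i)
    case 0
    then show ?case using Gz by simp
  next
    case (Suc i)
    have "(G *\<^sub>v z) \<bullet> v i = 0"
      unfolding ggkb_v_def using Suc Gz by (intro scalar_prod_wnormalize_eq_0) auto
    moreover have "(G *\<^sub>v z) \<bullet> (H *\<^sub>v u (Suc i)) = 0"
    proof -
      have "(G *\<^sub>v z) \<bullet> (H *\<^sub>v u (Suc i)) = z \<bullet> (AT *\<^sub>v (P *\<^sub>v u (Suc i)))"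
        using symmetric_scalar_prod[OF G G_sym z mult_mat_vec_carrier[OF H]] G_H_vec by simp
      also have "\<dots> = (P *\<^sub>v (A *\<^sub>v z)) \<bullet> u (Suc i)"
        using z scalar_prod_AT[OF z] symmetric_scalar_prod[OF P P_sym, of "A *\<^sub>v z"] by simp
      finally show ?thesis using PAz by simp
    qed
    ultimately show ?case
      unfolding v_rhs_Suc using Gz mult_mat_vec_carrier[OF H]
      by (subst scalar_prod_minus_distrib[of _ n]) auto
  qed
  then show ?thesis
    unfolding ggkb_v_def using Gz by (intro scalar_prod_wnormalize_eq_0) auto
qed

text \<open>If \<alpha> vanishes, \<open>alpha_v\<close> gives the claim; if \<beta> vanishes, so
  does \<open>u (Suc k)\<close> and with it both terms of the recurrence.\<close>

lemma v_rhs_eq_0_of_terminates: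
  assumes "ggkb_terminates_at A P Q b k"
  shows "v\<^sub>r (Suc k) = 0\<^sub>v n"
proof (cases "\<alpha> (Suc k) = 0")
  case True
  then have "v (Suc k) = 0\<^sub>v n" by (simp add: ggkb_alpha_def ggkb_v_def wnormalize_def carrier_vecD[OF rhs_carrier(2)])
  then show ?thesis using alpha_v[of "Suc k"] by (simp del: v_rhs.simps)
next
  case False
  then have "\<beta> (Suc k) = 0" using assms by (simp add: ggkb_terminates_at_def)
  moreover from this have "u (Suc k) = 0\<^sub>v m"
    by (simp add: ggkb_beta_def ggkb_u_def wnormalize_def carrier_vecD[OF rhs_carrier(1)])
  ultimately show ?thesis
    unfolding v_rhs_Suc using mult_mat_zero_vec[OF H] carrier_vecD[OF uv_carrier(2)[of k]]
    by (intro eq_vecI) (auto simp del: uv_carrier)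
qed

section \<open>Matrix form of the recurrences\<close>

definition U :: "nat \<Rightarrow> real mat" where
  "U k = mat_of_cols m (map u [1..<k + 1])"

abbreviation "V \<equiv> Vmat A P Q b"
abbreviation "B \<equiv> Bmat A P Q b"

lemma U [simp]: "U k \<in> carrier_mat m k" and V [simp]: "V k \<in> carrier_mat n k"
  and B [simp]: "B k \<in> carrier_mat (Suc k) k"
  by (auto simp: U_def Vmat_def Bmat_def mat_of_cols_def)

lemma col_U: "j < k \<Longrightarrow> col (U k) j = u (Suc j)"
  unfolding U_def by (subst col_mat_of_cols) (auto simp del: upt_Suc)

lemma col_V: "j < k \<Longrightarrow> col (V k) j = v (Suc j)"
  unfolding Vmat_def by (subst col_mat_of_cols) (auto simp del: upt_Suc)

lemma col_B:
  assumes "j < k"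
  shows "col (B k) j = \<alpha> (Suc j) \<cdot>\<^sub>v unit_vec (Suc k) j + \<beta> (Suc (Suc j)) \<cdot>\<^sub>v unit_vec (Suc k) (Suc j)"
  using assms by (intro eq_vecI) (auto simp: Bmat_def)

text \<open>The last row has no diagonal entry and the first no subdiagonal entry; the guard at
  \<open>j = 0\<close> matters because \<open>j - 1\<close> is 0 there.\<close>

lemma row_B:
  assumes "j < Suc k"
  shows "row (B k) j = (if j < k then \<alpha> (Suc j) else 0) \<cdot>\<^sub>v unit_vec k j
    + (if j = 0 then 0 else \<beta> (Suc j)) \<cdot>\<^sub>v unit_vec k (j - 1)"
  using assms by (intro eq_vecI) (auto simp: Bmat_def)

text \<open>Column \<open>j\<close> is the recurrence for \<open>u (Suc (Suc j))\<close>, solved for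
  its leading term.\<close>

lemma PPAV: "P * pinv P * A * V k = U (Suc k) * B k"
proof (rule mat_col_eqI)
  fix j assume "j < dim_col (U (Suc k) * B k)"
  then have j: "j < k" using B[of k] by (simp del: B)
  have "col (U (Suc k) * B k) j = \<alpha> (Suc j) \<cdot>\<^sub>v u (Suc j) + \<beta> (Suc (Suc j)) \<cdot>\<^sub>v u (Suc (Suc j))"
    using j by (simp add: col_mult2[OF U B] col_B mult_add_distrib_mat_vec[OF U] mult_mat_vec[OF U]
        mult_unit_vec[OF U] col_U)
  also have "\<dots> = (P * pinv P * A) *\<^sub>v v (Suc j)"
    unfolding beta_u u_rhs_Suc_Suc
    using uv_carrier(1)[of "Suc j"] mult_mat_vec_carrier[OF PPA uv_carrier(2), of "Suc j"]
    by (intro eq_vecI) (auto simp del: uv_carrier)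
  also have "\<dots> = col (P * pinv P * A * V k) j"
    using j by (simp add: col_mult2[OF PPA V] col_V)
  finally show "col (P * pinv P * A * V k) j = col (U (Suc k) * B k) j" ..
qed (use carrier_matD[OF U] carrier_matD[OF V] carrier_matD[OF B] in auto)

text \<open>Column \<open>j\<close> is the recurrence for \<open>v (Suc j)\<close>. For
  \<open>j = k\<close> this vector is not a column of \<open>V k\<close>; termination removes its
  term.\<close>

lemma HU:
  assumes "ggkb_terminates_at A P Q b k"
  shows "H * U (Suc k) = V k * transpose_mat (B k)"
proof (rule mat_col_eqI)
  have BT: "transpose_mat (B k) \<in> carrier_mat k (Suc k)" by simp
  fix j assume "j < dim_col (V k * transpose_mat (B k))"
  then have j: "j < Suc k" using B[of k] by (simp del: B)
  have "col (V k * transpose_mat (B k)) j = V k *\<^sub>v row (B k) j"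
    using j B[of k] by (simp add: col_mult2[OF V BT] del: B)
  also have "\<dots> = v\<^sub>r (Suc j) + \<beta> (Suc j) \<cdot>\<^sub>v v j"
  proof -
    have 1: "V k *\<^sub>v ((if j < k then \<alpha> (Suc j) else 0) \<cdot>\<^sub>v unit_vec k j) = v\<^sub>r (Suc j)"
    proof (cases "j < k")
      case True
      then show ?thesis by (simp add: mult_mat_vec[OF V] mult_unit_vec[OF V] col_V alpha_v del: v_rhs.simps)
    next
      case False
      then have "j = k" using j by simp
      then show ?thesis 
        using v_rhs_eq_0_of_terminates[OF assms] V[of k]
        by (intro eq_vecI) (auto simp: mult_mat_vec[OF V] simp del: v_rhs.simps V)
    qed
    have 2: "V k *\<^sub>v ((if j = 0 then 0 else \<beta> (Suc j)) \<cdot>\<^sub>v unit_vec k (j - 1)) = \<beta> (Suc j) \<cdot>\<^sub>v v j"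
    proof (cases j)
      case 0
      then have "v j = 0\<^sub>v n" by (simp add: ggkb_v_def wnormalize_def)
      then show ?thesis using 0 V[of k] by (intro eq_vecI) (auto simp: mult_mat_vec[OF V] simp del: V)
    next
      case (Suc i)
      then show ?thesis using j by (simp add: mult_mat_vec[OF V] mult_unit_vec[OF V] col_V)
    qed
    show ?thesis using 1 2 by (simp add: row_B[OF j] mult_add_distrib_mat_vec[OF V] del: v_rhs.simps)
  qed
  also have "\<dots> = H *\<^sub>v u (Suc j)"
    unfolding v_rhs_Suc
    using uv_carrier(2)[of j] mult_mat_vec_carrier[OF H uv_carrier(1), of "Suc j"]
    by (intro eq_vecI) (auto simp del: uv_carrier)
  also have "\<dots> = col (H * U (Suc k)) j"
    using j by (simp add: col_mult2[OF H U] col_U)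
  finally show "col (H * U (Suc k)) j = col (V k * transpose_mat (B k)) j" ..
qed (use carrier_matD[OF U] carrier_matD[OF V] carrier_matD[OF B] in auto)

subsection \<open>Optimality of the final iterate\<close>

abbreviation "y\<^sub>r k \<equiv> pinv (B k) *\<^sub>v (\<beta> 1 \<cdot>\<^sub>v unit_vec (Suc k) 0)"

lemma y_carrier [simp]: "y\<^sub>r k \<in> carrier_vec k"
  using mult_mat_vec_carrier[OF pinv_carrier[OF B]] by simp

text \<open>For \<open>k = 0\<close> the coefficient vector is empty, so the general formula also
  yields the zero start vector.\<close>

lemma glsqr_eq: "glsqr A P Q b k = V k *\<^sub>v y\<^sub>r k"
proof (cases "k = 0")
  case True
  then have "y\<^sub>r k = 0\<^sub>v k" using carrier_vecD[OF y_carrier[of k]] by (intro eq_vecI) auto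
  then have "V k *\<^sub>v y\<^sub>r k = 0\<^sub>v n" using mult_mat_zero_vec[OF V] by metis
  then show ?thesis using True by (simp add: glsqr_def)
qed (simp add: glsqr_def)

lemma glsqr_carrier [simp]: "glsqr A P Q b k \<in> carrier_vec n"
  using mult_mat_vec_carrier[OF V y_carrier] by (simp add: glsqr_eq)

text \<open>The iterate is in the span of the \<open>v i\<close>; this transfers the kernel
  orthogonalities to it.\<close>

lemma perp_glsqr:
  assumes y: "y \<in> carrier_vec n" and perp: "\<And>i. y \<bullet> v i = 0"
  shows "y \<bullet> glsqr A P Q b k = 0"
proof -
  have "transpose_mat (V k) *\<^sub>v y = 0\<^sub>v k"
    using V[of k] y perp comm_scalar_prod[OF uv_carrier(2) y]
    by (intro eq_vecI) (auto simp: col_V simp del: V)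
  moreover have "y \<bullet> glsqr A P Q b k = (transpose_mat (V k) *\<^sub>v y) \<bullet> y\<^sub>r k"
    unfolding glsqr_eq by (rule transpose_vec_mult_scalar[OF V y_carrier y, symmetric])
  ultimately show ?thesis using scalar_prod_left_zero[OF y_carrier] by metis
qed

text \<open>\<open>H\<close> maps the residual to \<open>V k\<close> times the normal residual of
  the bidiagonal problem, which is zero; \<open>G\<close> then turns \<open>H\<close> into A^T
  P.\<close>

lemma glsqr_normal_equation:
  assumes "ggkb_terminates_at A P Q b k"
  shows "AT *\<^sub>v (P *\<^sub>v (A *\<^sub>v glsqr A P Q b k - b)) = 0\<^sub>v n"
proof -
  define x where "x = glsqr A P Q b k"
  define c where "c = \<beta> 1 \<cdot>\<^sub>v unit_vec (Suc k) 0"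
  define y where "y = y\<^sub>r k"
  have c: "c \<in> carrier_vec (Suc k)" by (simp add: c_def)
  have y: "y \<in> carrier_vec k" by (simp only: y_def y_carrier)
  have x: "x \<in> carrier_vec n" by (simp add: x_def)
  have By: "B k *\<^sub>v y \<in> carrier_vec (Suc k)" using mult_mat_vec_carrier[OF B y] .
  have BT: "transpose_mat (B k) \<in> carrier_mat k (Suc k)" by simp
  have BBc: "B k * pinv (B k) \<in> carrier_mat (Suc k) (Suc k)"
    by (intro mult_carrier_mat[OF B] pinv_carrier[OF B])
  have "transpose_mat (B k) *\<^sub>v (B k *\<^sub>v y) = (transpose_mat (B k) * (B k * pinv (B k))) *\<^sub>v c"
    using c assoc_mult_mat_vec[OF BT BBc c] assoc_mult_mat_vec[OF B pinv_carrier[OF B] c]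
    by (simp add: y_def c_def)
  then have normal: "transpose_mat (B k) *\<^sub>v (B k *\<^sub>v y) = transpose_mat (B k) *\<^sub>v c"
    using transpose_mult_mult_pinv[OF B] by simp
  \<comment> \<open>The projected data is \<open>\<beta> 1\<close> times the first column of
    \<open>U (Suc k)\<close>, hence the image of \<open>c\<close>.\<close>
  have "(P * pinv P) *\<^sub>v b = U (Suc k) *\<^sub>v c"
    using beta_u[of 1] by (simp add: c_def mult_mat_vec[OF U] mult_unit_vec[OF U] col_U)
  moreover have "(P * pinv P) *\<^sub>v (A *\<^sub>v x) = U (Suc k) *\<^sub>v (B k *\<^sub>v y)"
  proof -
    have "(P * pinv P) *\<^sub>v (A *\<^sub>v x) = (P * pinv P * A * V k) *\<^sub>v y"
      using assoc_mult_mat_vec[OF PP A x] assoc_mult_mat_vec[OF PPA V y]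
      by (simp add: x_def glsqr_eq y_def)
    then show ?thesis using assoc_mult_mat_vec[OF U B y] by (simp add: PPAV)
  qed
  ultimately have proj: "(P * pinv P) *\<^sub>v (A *\<^sub>v x - b) = U (Suc k) *\<^sub>v (B k *\<^sub>v y - c)"
    using x c By by (simp add: mult_minus_distrib_mat_vec[OF PP] mult_minus_distrib_mat_vec[OF U])
  have r: "A *\<^sub>v x - b \<in> carrier_vec m" using mult_mat_vec_carrier[OF A x] by simp
  \<comment> \<open>The rightmost factor of \<open>H\<close> is \<open>P\<close>, which does not see
    the projection \<open>P * pinv P\<close>.\<close>
  have "H *\<^sub>v (A *\<^sub>v x - b) = H *\<^sub>v ((P * pinv P) *\<^sub>v (A *\<^sub>v x - b))"
    using r mult_mat_vec_carrier[OF PP r] by (simp add: H_mult_vec P_PP_vec)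
  also have "\<dots> = (H * U (Suc k)) *\<^sub>v (B k *\<^sub>v y - c)"
    using assoc_mult_mat_vec[OF H U] By c proj by simp
  also have "\<dots> = V k *\<^sub>v (transpose_mat (B k) *\<^sub>v (B k *\<^sub>v y - c))"
    using HU[OF assms] assoc_mult_mat_vec[OF V BT] By c by simp
  also have "transpose_mat (B k) *\<^sub>v (B k *\<^sub>v y - c) = 0\<^sub>v k"
    using normal By c mult_mat_vec_carrier[OF BT c] by (simp add: mult_minus_distrib_mat_vec[OF BT])
  also have "V k *\<^sub>v 0\<^sub>v k = 0\<^sub>v n" using V[of k] by (intro eq_vecI) (auto simp del: V)
  finally have "G *\<^sub>v (H *\<^sub>v (A *\<^sub>v x - b)) = G *\<^sub>v 0\<^sub>v n" by simp
  then show ?thesis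
    using G_H_vec[OF r] mult_mat_zero_vec[OF G] by (simp add: x_def)
qed

text \<open>The normal equation removes the cross term, so the squared objective is its value at
  \<open>x\<close> plus \<open>?q\<close>. As \<open>?q\<close> vanishes at \<open>x\<close>, the
  minimizers are exactly its zeros.\<close>

lemma mem_ls_minimizers_iff:
  assumes x: "x \<in> carrier_vec n" and normal: "AT *\<^sub>v (P *\<^sub>v (A *\<^sub>v x - b)) = 0\<^sub>v n"
  shows "y \<in> ls_minimizers A P b \<longleftrightarrow> y \<in> carrier_vec n \<and> P *\<^sub>v (A *\<^sub>v (y - x)) = 0\<^sub>v m"
proof -
  let ?f = "\<lambda>y. wnorm P (A *\<^sub>v y - b)"
  let ?q = "\<lambda>y. (A *\<^sub>v (y - x)) \<bullet> (P *\<^sub>v (A *\<^sub>v (y - x)))"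
  have r: "A *\<^sub>v x - b \<in> carrier_vec m" using mult_mat_vec_carrier[OF A x] by simp
  have f: "?f y = sqrt ((A *\<^sub>v x - b) \<bullet> (P *\<^sub>v (A *\<^sub>v x - b)) + ?q y)" if y: "y \<in> carrier_vec n" for y
  proof -
    have "A *\<^sub>v y - b = (A *\<^sub>v x - b) + A *\<^sub>v (y - x)"
      unfolding mult_minus_distrib_mat_vec[OF A y x]
      using carrier_vecD[OF b] by (intro eq_vecI) (auto simp del: b)
    moreover have "(A *\<^sub>v (y - x)) \<bullet> (P *\<^sub>v (A *\<^sub>v x - b)) = 0"
      using scalar_prod_AT[of "y - x" "P *\<^sub>v (A *\<^sub>v x - b)"] x y r normal
      by (metis P minus_carrier_vec mult_mat_vec_carrier scalar_prod_right_zero)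
    ultimately show ?thesis
      unfolding wnorm_def using quadratic_form_add[OF P P_sym r] x y by simp
  qed
  have q_nonneg: "?q y \<ge> 0" if "y \<in> carrier_vec n" for y
    using P_psd x that by (simp add: sym_psd_def)
  have q_x: "?q x = 0"
    using x mult_mat_zero_vec[OF A] mult_mat_zero_vec[OF P] by simp
  have "y \<in> ls_minimizers A P b \<longleftrightarrow> y \<in> carrier_vec n \<and> ?q y = 0"
  proof (cases "y \<in> carrier_vec n")
    case True
    have "?q y = 0 \<longleftrightarrow> \<not> (\<exists>z \<in> carrier_vec n. ?q z < ?q y)"
      using q_nonneg True q_x x by (metis less_le not_less)
    then show ?thesis
      using True f by (auto simp: ls_minimizers_def is_arg_min_def)
  qed (simp add: ls_minimizers_def is_arg_min_def)
  also have "\<dots> \<longleftrightarrow> y \<in> carrier_vec n \<and> P *\<^sub>v (A *\<^sub>v (y - x)) = 0\<^sub>v m"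
    using sym_psd_form_eq_0[OF P_psd, of "A *\<^sub>v (y - x)"] x by auto
  finally show ?thesis .
qed

lemma glsqr_min_norm_solution:
  assumes "ggkb_terminates_at A P Q b k"
  shows "is_min_norm_gls_solution A P Q b (glsqr A P Q b k)"
proof -
  define x where "x = glsqr A P Q b k"
  have x [simp]: "x \<in> carrier_vec n" by (simp add: x_def)
  let ?L = "ls_minimizers A P b"
  have L: "y \<in> ?L \<longleftrightarrow> y \<in> carrier_vec n \<and> P *\<^sub>v (A *\<^sub>v (y - x)) = 0\<^sub>v m" for y
    using mem_ls_minimizers_iff[OF x] glsqr_normal_equation[OF assms] by (simp add: x_def)
  have xL: "x \<in> ?L"
    using L[of x] x mult_mat_zero_vec[OF A] mult_mat_zero_vec[OF P] by simp
  have split: "y = x + (y - x)" if "y \<in> carrier_vec n" for y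
    using that x by (intro eq_vecI) (auto simp del: x)
  have wQ: "wnorm Q y = sqrt (x \<bullet> (Q *\<^sub>v x) + (y - x) \<bullet> (Q *\<^sub>v (y - x)))" if "y \<in> ?L" for y
  proof -
    define d where "d = y - x"
    have y: "y \<in> carrier_vec n" and d: "d \<in> carrier_vec n" and PAd: "P *\<^sub>v (A *\<^sub>v d) = 0\<^sub>v m"
      using that L by (auto simp: d_def)
    \<comment> \<open>On differences of minimizers \<open>G\<close> and \<open>Q\<close> agree, so
      orthogonality of the iterate to \<open>G d\<close> is the vanishing \<open>Q\<close> cross
      term.\<close>
    have "G *\<^sub>v d = Q *\<^sub>v d"
    proof -
      have "AT *\<^sub>v 0\<^sub>v m = 0\<^sub>v n" by (intro eq_vecI) auto
      then show ?thesis using d by (simp add: G_mult_vec PAd)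
    qed
    moreover have "(G *\<^sub>v d) \<bullet> x = 0"
      unfolding x_def using mult_mat_vec_carrier[OF G d] kernel_PA_perp_Gv[OF d PAd] by (rule perp_glsqr)
    ultimately have "d \<bullet> (Q *\<^sub>v x) = 0"
      using symmetric_scalar_prod[OF Q Q_sym d x] by simp
    from quadratic_form_add[OF Q Q_sym x d this] show ?thesis
      unfolding wnorm_def using split[OF y] by (simp add: d_def)
  qed
  have Q_nonneg: "0 \<le> z \<bullet> (Q *\<^sub>v z)" if "z \<in> carrier_vec n" for z
    using Q_psd that by (simp add: sym_psd_def)
  have "wnorm Q x \<le> wnorm Q y" if "y \<in> ?L" for y
    using wQ[OF that] Q_nonneg[of "y - x"] that L by (simp add: wnorm_def)
  then have "x \<in> gls_solutions A P Q b"
    using xL by (auto simp: gls_solutions_def is_arg_min_def not_less)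
  moreover have "norm2 x < norm2 y" if sol: "y \<in> gls_solutions A P Q b" and neq: "y \<noteq> x" for y
  proof -
    define d where "d = y - x"
    have yL: "y \<in> ?L" and "wnorm Q y \<le> wnorm Q x"
      using sol xL by (auto simp: gls_solutions_def is_arg_min_def not_less)
    then have y: "y \<in> carrier_vec n" and d: "d \<in> carrier_vec n" and PAd: "P *\<^sub>v (A *\<^sub>v d) = 0\<^sub>v m"
      and "d \<bullet> (Q *\<^sub>v d) \<le> 0"
      using L wQ[OF yL] by (auto simp: d_def wnorm_def)
    \<comment> \<open>Both summands of \<open>G_form\<close> vanish, so two solutions differ by an
      element of the kernel of \<open>G\<close>.\<close>
    then have "d \<bullet> (G *\<^sub>v d) = 0" using Q_nonneg[OF d] by (simp add: G_form)
    then have "G *\<^sub>v d = 0\<^sub>v n" using sym_psd_form_eq_0[OF G_psd d] by simp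
    then have "d \<bullet> x = 0"
      unfolding x_def using kernel_G_perp_v[OF d] by (intro perp_glsqr[OF d])
    \<comment> \<open>Euclidean Pythagoras, the form being the identity; strictness comes from
      \<open>d\<close> being nonzero.\<close>
    then have "y \<bullet> y = x \<bullet> x + d \<bullet> d"
      using quadratic_form_add[of "1\<^sub>m n" n x d] split[OF y] d y by (simp add: d_def)
    moreover have "d \<bullet> d > 0"
    proof -
      have "d \<noteq> 0\<^sub>v n" using neq split[OF y] x by (metis d_def right_zero_vec)
      then show ?thesis using scalar_prod_self_eq_0_iff[OF d] scalar_prod_self_ge_0[of d] by linarith
    qed
    ultimately show ?thesis by (simp add: norm2_def)
  qed
  ultimately show ?thesis by (simp add: is_min_norm_gls_solution_def x_def)
qed

end

theorem theorem4p3: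
  fixes m n kt :: nat and A P Q :: "real mat" and b :: "real vec"
  assumes "A \<in> carrier_mat m n"
    and "sym_psd m P"
    and "sym_psd n Q"
    and "b \<in> carrier_vec m"
    and "(P * pinv P) *\<^sub>v b \<noteq> 0\<^sub>v m"
    and "ggkb_terminates_at A P Q b kt"
  shows "is_min_norm_gls_solution A P Q b (glsqr A P Q b kt)"
proof -
  interpret ggkb_problem m n A P Q b
    using assms by unfold_locales
  show ?thesis using glsqr_min_norm_solution assms by blast
qed

end
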